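(* Let $i\in\{1,2\}$. Define a sequence $(c^{(i)}_n)_{n\geq -2}$ of polynomials in $q$ by $c^{(i)}_{-2}=c^{(i)}_{-1}=0$, $c^{(i)}_0=1$, $c^{(i)}_1=q^i+q^3$, and for $n\geq 0$ \[ c^{(i)}_{n+2} = -q^{3n+3}(1-q^3)c^{(i)}_{n+1}+q^{3n+4}(1+q+2q^{3n+2})c^{(i)}_{n} -q^{6n+3}(1-q^3)(1-q^{3n})c^{(i)}_{n-1}-q^{6n+3}(1-q^{3n})(1-q^{3n-3})c^{(i)}_{n-2}. \] Then, as formal power series in $q$, \[ \sum_{n\geq 0}\frac{c^{(1)}_n}{(q^3;q^3)_n} = \frac{(q^2,q^{10};q^{12})_{\infty}}{(q,q^3,q^5,q^7,q^9,q^{11};q^{12})_{\infty}},\qquad \sum_{n\geq 0}\frac{c^{(2)}_n}{(q^3;q^3)_n} = \frac{1}{(q^2,q^3,q^{9},q^{10};q^{12})_{\infty}}. \]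
   Context: Standard $q$-Pochhammer notation: $(a;q)_n=\prod_{k=0}^{n-1}(1-aq^k)$, $(a;q)_\infty=\prod_{k\geq 0}(1-aq^k)$, and $(a_1,\dots,a_m;q)_\infty=\prod_{j=1}^m(a_j;q)_\infty$. *)

theory Defs
  imports "HOL-Computational_Algebra.Formal_Power_Series"
begin

definition fps_qpoch :: "nat \<Rightarrow> nat \<Rightarrow> nat \<Rightarrow> rat fps" where
  "fps_qpoch a m n = (\<Prod>k<n. 1 - fps_X ^ (a + m * k))"

(* infinite q-Pochhammer (X^a; X^m)_\<infinity>, the limit of the partial products
   in the standard (X-adic) topology of formal power series *)
definition fps_qpoch_inf :: "nat \<Rightarrow> nat \<Rightarrow> rat fps" where
  "fps_qpoch_inf a m = lim (fps_qpoch a m)"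

(* cshift i m = c^(i)_(m-2), so that indices -2,-1 become 0,1 *)
fun cshift :: "nat \<Rightarrow> nat \<Rightarrow> rat fps" where
  "cshift i 0 = 0"
| "cshift i (Suc 0) = 0"
| "cshift i (Suc (Suc 0)) = 1"
| "cshift i (Suc (Suc (Suc 0))) = fps_X ^ i + fps_X ^ 3"
| "cshift i (Suc (Suc (Suc (Suc n)))) =
     - (fps_X ^ (3*n+3) * (1 - fps_X ^ 3) * cshift i (n+3))
     + fps_X ^ (3*n+4) * (1 + fps_X + 2 * fps_X ^ (3*n+2)) * cshift i (n+2)
     - fps_X ^ (6*n+3) * (1 - fps_X ^ 3) * (1 - fps_X ^ (3*n)) * cshift i (n+1)
     - fps_X ^ (6*n+3) * (1 - fps_X ^ (3*n)) * (1 - fps_X ^ (3*n-3)) * cshift i n"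

definition cseq :: "nat \<Rightarrow> nat \<Rightarrow> rat fps" where
  "cseq i n = cshift i (n + 2)"

end

theory Submission
  imports Defs
begin

text \<open>
  Write \<open>Q = q\<^sup>3\<close> and \<open>a\<^sub>n = c\<^sub>n / (Q;Q)\<^sub>n\<close>. The recurrence is a second-order \<open>Q\<close>-difference equation
  for \<open>F(x) = \<Sum> a\<^sub>n x\<^sup>n\<close>. Its leading coefficient contains the factor \<open>1 - x Q\<close>, which cancels on passing to
  \<open>G(x) = F(x) / (x;Q)\<^sub>\<infinity>\<close>. By Abel's lemma \<open>F(1)\<close> is the limit of \<open>h\<^sub>n = (Q;Q)\<^sub>n [x\<^sup>n] G(x)\<close>, and the equation
  for \<open>G\<close> becomes a recurrence for \<open>h\<^sub>n\<close> of the kind that counts Capparelli's partitions, whose only other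
  parameters are \<open>A = q\<^sup>i\<close> and \<open>B = q\<^sup>3 / A\<close>.

  For independent \<open>A\<close> and \<open>B\<close> the solution satisfies
  \<open>h\<^sub>n\<^sub>+\<^sub>1(A, B) = (1 + A) h\<^sub>n(B Q, A Q) + Q\<^sup>n\<^sup>+\<^sup>1 h\<^sub>n(A, B)\<close>. In the limit \<open>H(A, B) = (1 + A) H(B Q, A Q)\<close>, so
  \<open>H(A, B) = (-A, -B Q; Q\<^sup>2)\<^sub>\<infinity> (-Q; Q)\<^sub>\<infinity>\<close>, and the stated products follow from
  \<open>(-x; q)\<^sub>\<infinity> (x; q)\<^sub>\<infinity> = (x\<^sup>2; q\<^sup>2)\<^sub>\<infinity>\<close> by splitting residue classes.
\<close>

lemma nat_cases_3 [case_names 1 2 3 4]: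
  fixes n :: nat
  obtains "n = 0" | "n = 1" | "n = 2" | m where "n = m + 3"
  by (metis One_nat_def Suc_1 add.commute add_2_eq_Suc' less_2_cases not_less_eq
      numeral_3_eq_3 less_Suc_eq le_add_diff_inverse not_less)

subsection \<open>Limits of formal power series\<close>

text \<open>Divisibility of a difference by \<open>fps_X ^ n\<close> is agreement of two series
  below degree n. All error estimates are stated as such divisibilities.\<close>

lemma X_power_dvd_iff: "fps_X ^ n dvd (f :: 'a::comm_ring_1 fps) \<longleftrightarrow> (\<forall>k<n. fps_nth f k = 0)"
proof
  assume "fps_X ^ n dvd f"
  then show "\<forall>k<n. fps_nth f k = 0" by (auto simp: fps_X_power_mult_nth elim!: dvdE)
next
  assume *: "\<forall>k<n. fps_nth f k = 0"
  show "fps_X ^ n dvd f"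
    by (rule dvdI[of _ _ "fps_shift n f"], rule fps_ext) (use * in \<open>auto simp: fps_X_power_mult_nth\<close>)
qed

lemma tendsto_mult_fps:
  fixes f g :: "'b \<Rightarrow> 'a::{ring} fps"
  assumes "(f \<longlongrightarrow> L) F" "(g \<longlongrightarrow> M) F"
  shows "((\<lambda>x. f x * g x) \<longlongrightarrow> L * M) F"
proof (rule tendsto_fpsI)
  fix n
  have "\<forall>\<^sub>F x in F. \<forall>k\<in>{..n}. fps_nth (f x) k = fps_nth L k"
       "\<forall>\<^sub>F x in F. \<forall>k\<in>{..n}. fps_nth (g x) k = fps_nth M k"
    using assms by (auto simp: eventually_ball_finite_distrib tendsto_fps_iff)
  then show "\<forall>\<^sub>F x in F. fps_nth (f x * g x) n = fps_nth (L * M) n"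
    by eventually_elim (simp add: fps_mult_nth)
qed

lemma tendsto_fps_cong:
  fixes f g :: "nat \<Rightarrow> 'a::comm_ring_1 fps"
  assumes "\<And>n. fps_X ^ n dvd f n - g n" "g \<longlonglongrightarrow> L"
  shows "f \<longlonglongrightarrow> L"
proof (rule tendsto_fpsI)
  fix n
  have "\<forall>\<^sub>F m in sequentially. fps_nth (g m) n = fps_nth L n"
    using assms(2) by (simp add: tendsto_fps_iff)
  with eventually_gt_at_top[of n]
  show "\<forall>\<^sub>F m in sequentially. fps_nth (f m) n = fps_nth L n"
  proof eventually_elim
    case (elim m)
    then show ?case using assms(1)[of m] by (auto simp: X_power_dvd_iff)
  qed
qed

text \<open>Coefficient n no longer changes from index \<open>Suc n\<close> on, so the sequence of
  stable coefficients is the limit.\<close>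

lemma convergent_fpsI:
  fixes f :: "nat \<Rightarrow> 'a::comm_ring_1 fps"
  assumes "\<And>n. fps_X ^ n dvd f (Suc n) - f n"
  shows "f \<longlonglongrightarrow> lim f"
proof -
  have stable: "fps_nth (f m) n = fps_nth (f (Suc n)) n" if "Suc n \<le> m" for m n
    using that
  proof (induction m rule: dec_induct)
    case (step m)
    then show ?case using assms[of m] by (auto simp: X_power_dvd_iff)
  qed auto
  have "f \<longlonglongrightarrow> Abs_fps (\<lambda>n. fps_nth (f (Suc n)) n)"
  proof (rule tendsto_fpsI)
    fix n
    show "\<forall>\<^sub>F m in sequentially. fps_nth (f m) n = fps_nth (Abs_fps (\<lambda>n. fps_nth (f (Suc n)) n)) n"
      using eventually_ge_at_top[of "Suc n"] 
    proof eventually_elim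
      case (elim m)
      then show ?case unfolding fps_nth_Abs_fps by (rule stable)
    qed
  qed
  then show ?thesis by (simp add: convergent_LIMSEQ_iff[symmetric] convergentI)
qed

lemma fps_nth_lim:
  fixes f :: "nat \<Rightarrow> 'a::comm_ring_1 fps"
  assumes "f \<longlonglongrightarrow> L" "\<And>n. fps_nth (f n) k = c"
  shows "fps_nth L k = c"
proof -
  have "\<forall>\<^sub>F n in sequentially. fps_nth (f n) k = fps_nth L k"
    using assms(1) by (simp add: tendsto_fps_iff)
  then show ?thesis using assms(2) by simp
qed

subsection \<open>Infinite products\<close>

text \<open>This is (c X^a; X^m)_infinity. The case c = 1 is \<open>fps_qpoch_inf\<close>; c = -1
  gives the products with plus signs that the limit produces first.\<close>

definition qprod :: "rat fps \<Rightarrow> nat \<Rightarrow> nat \<Rightarrow> rat fps" where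
  "qprod c a m = lim (\<lambda>n. \<Prod>k<n. 1 - c * fps_X ^ (a + m * k))"

lemma qprod_tendsto:
  assumes "m > 0"
  shows "(\<lambda>n. \<Prod>k<n. 1 - c * fps_X ^ (a + m * k)) \<longlonglongrightarrow> qprod c a m"
  unfolding qprod_def
proof (rule convergent_fpsI)
  fix n
  have "n \<le> a + m * n" using assms by (cases m) auto
  then have "fps_X ^ n dvd (fps_X ^ (a + m * n) :: rat fps)" by (rule le_imp_power_dvd)
  moreover have "(\<Prod>k<Suc n. 1 - c * fps_X ^ (a + m * k)) - (\<Prod>k<n. 1 - c * fps_X ^ (a + m * k))
     = fps_X ^ (a + m * n) * (- c * (\<Prod>k<n. 1 - c * fps_X ^ (a + m * k)))"
    by (simp add: algebra_simps)
  ultimately show "fps_X ^ n dvd (\<Prod>k<Suc n. 1 - c * fps_X ^ (a + m * k)) - (\<Prod>k<n. 1 - c * fps_X ^ (a + m * k))"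
    by simp
qed

lemma fps_qpoch_inf_eq_qprod: "fps_qpoch_inf a m = qprod 1 a m"
  by (simp add: fps_qpoch_inf_def qprod_def fps_qpoch_def[abs_def])

lemma qprod_nz:
  assumes "a > 0" "m > 0"
  shows "qprod c a m \<noteq> 0"
proof -
  have "fps_nth (\<Prod>k<n. 1 - c * fps_X ^ (a + m * k)) 0 = 1" for n
    using assms by (induction n) simp_all
  then have "fps_nth (qprod c a m) 0 = 1"
    using qprod_tendsto[OF assms(2)] by (rule fps_nth_lim[rotated])
  then show ?thesis by auto
qed

lemma qprod_neg_mult:
  assumes "m > 0"
  shows "qprod (-1) a m * qprod 1 a m = qprod 1 (2*a) (2*m)"
proof (rule LIMSEQ_unique)
  show "(\<lambda>n. (\<Prod>k<n. 1 - (-1) * fps_X ^ (a + m * k)) * (\<Prod>k<n. 1 - 1 * fps_X ^ (a + m * k)))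
      \<longlonglongrightarrow> qprod (-1) a m * qprod 1 a m"
    using assms by (intro tendsto_mult_fps qprod_tendsto)
  have "(\<Prod>k<n. 1 - (-1) * fps_X ^ (a + m * k)) * (\<Prod>k<n. 1 - 1 * fps_X ^ (a + m * k)) =
     (\<Prod>k<n. 1 - 1 * fps_X ^ (2*a + 2*m * k) :: rat fps)" for n
    unfolding prod.distrib[symmetric]
  proof (rule prod.cong)
    fix k
    have "fps_X ^ (2*a + 2*m * k) = (fps_X ^ (a + m * k) :: rat fps)^2"
      unfolding power_mult[symmetric] by (simp add: algebra_simps)
    then show "(1 - - 1 * fps_X ^ (a + m * k)) * (1 - 1 * fps_X ^ (a + m * k)) =
      (1 - 1 * fps_X ^ (2*a + 2*m * k) :: rat fps)"
      by (simp add: algebra_simps power2_eq_square)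
  qed simp
  then show "(\<lambda>n. (\<Prod>k<n. 1 - (-1) * fps_X ^ (a + m * k)) * (\<Prod>k<n. 1 - 1 * fps_X ^ (a + m * k)))
      \<longlonglongrightarrow> qprod 1 (2*a) (2*m)"
    using qprod_tendsto[of "2*m" 1 "2*a"] assms by simp
qed

text \<open>Even and odd k are separated in the product with 2n factors; these products form a
  subsequence of the partial products on the left.\<close>

lemma qprod_split:
  assumes "m > 0"
  shows "qprod c a m = qprod c a (2*m) * qprod c (a+m) (2*m)"
proof (rule LIMSEQ_unique)
  show "(\<lambda>n. (\<Prod>k<n. 1 - c * fps_X ^ (a + 2*m * k)) * (\<Prod>k<n. 1 - c * fps_X ^ (a + m + 2*m * k)))
      \<longlonglongrightarrow> qprod c a (2*m) * qprod c (a+m) (2*m)"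
    using assms by (intro tendsto_mult_fps qprod_tendsto) auto
  have "(\<Prod>k<n. 1 - c * fps_X ^ (a + 2*m * k)) * (\<Prod>k<n. 1 - c * fps_X ^ (a + m + 2*m * k))
      = (\<Prod>k<2*n. 1 - c * fps_X ^ (a + m * k))" for n
    by (induction n) (simp_all add: algebra_simps)
  moreover have "(\<lambda>n. \<Prod>k<2*n. 1 - c * fps_X ^ (a + m * k)) \<longlonglongrightarrow> qprod c a m"
    by (rule filterlim_compose[OF qprod_tendsto[OF assms]])
       (auto intro!: filterlim_subseq simp: strict_mono_def)
  ultimately show "(\<lambda>n. (\<Prod>k<n. 1 - c * fps_X ^ (a + 2*m * k)) * (\<Prod>k<n. 1 - c * fps_X ^ (a + m + 2*m * k)))
      \<longlonglongrightarrow> qprod c a m"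
    by simp
qed

subsection \<open>Capparelli's recurrence\<close>

text \<open>The recurrence is symmetric in A and B; only the value at index 1 tells them apart. The
  value at index 2 is the recurrence read at n = -1, where the factor 1 - Q^(n+1) removes the last
  term.\<close>

fun capparelli :: "'a::comm_ring_1 \<Rightarrow> 'a \<Rightarrow> 'a \<Rightarrow> nat \<Rightarrow> 'a" where
  "capparelli Q A B 0 = 1"
| "capparelli Q A B (Suc 0) = 1 + A + Q"
| "capparelli Q A B (Suc (Suc 0)) = (1 + Q^2) * (1 + A + Q) + Q * (A + B + A * B)"
| "capparelli Q A B (Suc (Suc (Suc n))) =
     (1 + Q^(n+3)) * capparelli Q A B (n+2)
     + Q^(n+2) * (A + B + A * B * Q^(n+1)) * capparelli Q A B (n+1)
     + A * B * Q^(2*n+3) * (1 - Q^(n+1)) * capparelli Q A B n"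

text \<open>With h_n and g_n the values at (A, B) and (B Q, A Q), the combination h_(n+1) - Q^(n+1)
  h_n obeys the recurrence of g_n and has the initial values of (1 + A) g_n.\<close>

lemma capparelli_swap:
  "capparelli Q A B (Suc n) = (1 + A) * capparelli Q (B*Q) (A*Q) n + Q ^ Suc n * capparelli Q A B n"
proof (induction n rule: less_induct)
  case (less n)
  show ?case
  proof (cases n rule: nat_cases_3)
    case (4 m)
    define y where "y = Q ^ m"
    define h where "h k = capparelli Q A B (m + k)" for k
    define g where "g k = capparelli Q (B*Q) (A*Q) (m + k)" for k
    have h4: "h 4 = (1 + y*Q^4) * h 3 + y*Q^3 * (A + B + A*B*y*Q^2) * h 2
                + A*B*y^2*Q^5 * (1 - y*Q^2) * h 1"
      using capparelli.simps(4)[of Q A B "Suc m"]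
      by (simp add: h_def y_def eval_nat_numeral power_add power_mult algebra_simps)
    have h3: "h 3 = (1 + y*Q^3) * h 2 + y*Q^2 * (A + B + A*B*y*Q) * h 1
                + A*B*y^2*Q^3 * (1 - y*Q) * h 0"
      using capparelli.simps(4)[of Q A B m]
      by (simp add: h_def y_def eval_nat_numeral power_add power_mult algebra_simps)
    have g3: "g 3 = (1 + y*Q^3) * g 2 + y*Q^2 * (B*Q + A*Q + B*Q*(A*Q)*y*Q) * g 1
                + B*Q*(A*Q)*y^2*Q^3 * (1 - y*Q) * g 0"
      using capparelli.simps(4)[of Q "B*Q" "A*Q" m]
      by (simp add: g_def y_def eval_nat_numeral power_add power_mult algebra_simps)
    have i0: "(1+A) * g 0 = h 1 - y*Q * h 0"
      using less.IH[of m] 4 by (simp add: h_def g_def y_def algebra_simps)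
    have i1: "(1+A) * g 1 = h 2 - y*Q^2 * h 1"
      using less.IH[of "m+1"] 4 by (simp add: h_def g_def y_def algebra_simps eval_nat_numeral)
    have i2: "(1+A) * g 2 = h 3 - y*Q^3 * h 2"
      using less.IH[of "m+2"] 4 by (simp add: h_def g_def y_def algebra_simps eval_nat_numeral)
    \<comment> \<open>Scaling by 1 + A lets the induction hypotheses replace each earlier g by
      values of h; expanding \<open>h 4\<close> and \<open>h 3\<close> then leaves a polynomial
      identity in A, B, Q, y.\<close>
    have "(1+A) * g 3 = (1 + y*Q^3) * ((1+A) * g 2)
            + y*Q^2 * (B*Q + A*Q + B*Q*(A*Q)*y*Q) * ((1+A) * g 1)
            + B*Q*(A*Q)*y^2*Q^3 * (1 - y*Q) * ((1+A) * g 0)"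
      unfolding g3 by (simp add: algebra_simps)
    also have "\<dots> = h 4 - y*Q^4 * h 3"
      unfolding i0 i1 i2 h4 h3 by (simp add: algebra_simps eval_nat_numeral)
    finally show ?thesis
      using 4 by (simp add: h_def g_def y_def algebra_simps eval_nat_numeral)
  qed (simp_all add: eval_nat_numeral algebra_simps)
qed

lemma capparelli_0_0: "capparelli Q 0 0 n = (\<Prod>k<n. 1 + Q ^ Suc k)"
  by (induction n) (use capparelli_swap[of Q 0 0] in \<open>simp_all add: algebra_simps\<close>)

text \<open>In the recurrence for index n+1, every term other than the bare predecessor carries Q^n.
  For Q = X^3 this gives convergence.\<close>

lemma capparelli_dvd_Suc:
  fixes Q :: "'a::comm_ring_1" shows "Q ^ n dvd capparelli Q A B (Suc n) - capparelli Q A B n"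
proof -
  consider "n = 0" | "n = 1" | m where "n = m + 2"
    by (cases n rule: nat_cases_3) (auto intro: that(3)[of 0] that(3)[of "Suc _"])
  then show ?thesis
  proof cases
    case 3
    have "capparelli Q A B (Suc n) - capparelli Q A B n = Q^(m+2) * (Q * capparelli Q A B (m+2)
        + (A + B + A * B * Q^(m+1)) * capparelli Q A B (m+1) + A * B * Q^(m+1) * (1 - Q^(m+1)) * capparelli Q A B m)"
      using capparelli.simps(4)[of Q A B m] 3
      by (simp add: eval_nat_numeral power_add power_mult power2_eq_square mult_2 algebra_simps)
    then show ?thesis using 3 by simp
  next
    case 2
    have "capparelli Q A B (Suc n) - capparelli Q A B n = Q * (Q * (1 + A + Q) + A + B + A * B)"
      using 2 by (simp add: eval_nat_numeral algebra_simps)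
    then show ?thesis using 2 by simp
  qed simp
qed

text \<open>Modulo d both parameters vanish. This disposes of the parameters once repeated swapping
  has made them highly divisible by X.\<close>

lemma capparelli_cong_dvd:
  fixes Q :: "'a::comm_ring_1"
  assumes "d dvd A" "d dvd B"
  shows "d dvd capparelli Q A B n - capparelli Q 0 0 n"
proof (induction n rule: less_induct)
  case (less n)
  show ?case
  proof (cases n rule: nat_cases_3)
    case (4 m)
    have "capparelli Q A B n - capparelli Q 0 0 n = (1 + Q^(m+3)) * (capparelli Q A B (m+2) - capparelli Q 0 0 (m+2))
        + A * (Q^(m+2) * (1 + B * Q^(m+1)) * capparelli Q A B (m+1) + B * Q^(2*m+3) * (1 - Q^(m+1)) * capparelli Q A B m)
        + B * (Q^(m+2) * capparelli Q A B (m+1))"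
      using capparelli.simps(4)[of Q A B m] capparelli.simps(4)[of Q 0 0 m] 4
      by (simp add: eval_nat_numeral algebra_simps)
    moreover have "d dvd (1 + Q^(m+3)) * (capparelli Q A B (m+2) - capparelli Q 0 0 (m+2))"
      using less.IH[of "m+2"] 4 by simp
    ultimately show ?thesis using assms by (metis dvd_add dvd_mult2)
  next
    case 3
    have "capparelli Q A B n - capparelli Q 0 0 n = A * (1 + Q^2 + Q + Q * B) + B * Q"
      using 3 by (simp add: eval_nat_numeral algebra_simps)
    then show ?thesis using assms by (metis dvd_add dvd_mult2)
  qed (use assms in simp_all)
qed

subsection \<open>The \<open>q\<close>-difference equations\<close>

lemma cseq_0: "cseq i 0 = 1" and cseq_1: "cseq i (Suc 0) = fps_X ^ i + fps_X ^ 3"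
  by (simp_all add: cseq_def)

definition q3 :: "rat fps" where "q3 = fps_X ^ 3"

text \<open>Indices 2 and 3 are treated apart because the recurrence reaches back to the zero values
  at -1 and -2. From index 4 on it involves only genuine terms, and \<open>3*n-3\<close> is not
  truncated.\<close>

lemma cseq_2: "cseq i 2 = fps_X * q3 * (1 + fps_X + 2 * fps_X^2) - q3 * (1 - q3) * cseq i 1"
proof -
  have c: "cshift i (0+k) = (if k < 2 then 0 else cseq i (k-2))" for k
    by (auto simp: cseq_def less_2_cases_iff simp flip: add_2_eq_Suc')
  have p: "fps_X ^ (3*0+3) = q3" "fps_X ^ (3*0+4) = fps_X * q3" "fps_X ^ (3*0+2) = (fps_X^2 :: rat fps)"
    by (simp_all add: q3_def flip: power_Suc)
  have "cseq i 2 = cshift i (Suc (Suc (Suc (Suc 0))))"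
    by (simp add: cseq_def eval_nat_numeral)
  also have "\<dots> = - (q3 * (1 - q3) * cseq i 1) + fps_X * q3 * (1 + fps_X + 2 * fps_X^2) * cseq i 0"
    unfolding cshift.simps(5) q3_def[symmetric] p c by simp
  finally show ?thesis by (simp add: cseq_0)
qed

lemma cseq_3:
  "cseq i 3 = fps_X * q3^2 * (1 + fps_X + 2 * fps_X^2 * q3) * cseq i 1
     - q3^2 * (1 - q3) * cseq i 2 - q3^3 * (1 - q3)^2"
proof -
  have c: "cshift i (1+k) = (if k = 0 then 0 else cseq i (k-1))" for k
    by (cases k) (simp_all add: cseq_def)
  have p: "fps_X ^ (3*1+3) = q3^2" "fps_X ^ (3*1+4) = fps_X * q3^2" "fps_X ^ (3*1+2) = fps_X^2 * q3"
      "fps_X ^ (6*1+3) = q3^3" "fps_X ^ (3*1) = q3" 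
    by (simp_all add: q3_def flip: power_mult power_add power_Suc power_Suc2)
  have "cseq i 3 = cshift i (Suc (Suc (Suc (Suc 1))))"
    by (simp add: cseq_def eval_nat_numeral)
  also have "\<dots> = - (q3^2 * (1 - q3) * cseq i 2)
     + fps_X * q3^2 * (1 + fps_X + 2 * (fps_X^2 * q3)) * cseq i 1
     - q3^3 * (1 - q3) * (1 - q3) * cseq i 0"
    unfolding cshift.simps(5) q3_def[symmetric] p c by simp
  finally show ?thesis by (simp add: cseq_0 power2_eq_square algebra_simps)
qed

lemma cseq_4:
  fixes n :: nat
  defines "y \<equiv> q3 ^ n"
  shows "cseq i (n+4) = fps_X * y * q3^3 * (1 + fps_X + 2 * fps_X^2 * y * q3^2) * cseq i (n+2)
     - y * q3^3 * (1 - q3) * cseq i (n+3)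
     - y^2 * q3^5 * (1 - q3) * (1 - y * q3^2) * cseq i (n+1)
     - y^2 * q3^5 * (1 - y * q3^2) * (1 - y * q3) * cseq i n"
proof -
  have p: "fps_X ^ (3*(n+2)+3) = y * q3^3" "fps_X ^ (3*(n+2)+4) = fps_X * y * q3^3"
      "fps_X ^ (3*(n+2)+2) = fps_X^2 * y * q3^2" "fps_X ^ (6*(n+2)+3) = y^2 * q3^5"
      "fps_X ^ (3*(n+2)) = y * q3^2" "fps_X ^ (3*(n+2)-3) = y * q3"
    by (simp_all add: q3_def y_def algebra_simps flip: power_mult power_add power_Suc power_Suc2)
  have c: "cshift i (n+2+k) = cseq i (n+k)" for k by (simp add: cseq_def)
  have "cseq i (n+4) = cshift i (Suc (Suc (Suc (Suc (n+2)))))"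
    by (simp add: cseq_def eval_nat_numeral)
  also have "\<dots> = - (y * q3^3 * (1 - q3) * cseq i (n+3))
     + fps_X * y * q3^3 * (1 + fps_X + 2 * (fps_X^2 * y * q3^2)) * cseq i (n+2)
     - y^2 * q3^5 * (1 - q3) * (1 - y * q3^2) * cseq i (n+1)
     - y^2 * q3^5 * (1 - y * q3^2) * (1 - y * q3) * cseq i n"
    unfolding cshift.simps(5) q3_def[symmetric] p c using c[of 0] by simp
  finally show ?thesis by (simp add: algebra_simps)
qed

definition qfac :: "nat \<Rightarrow> rat fps" where "qfac n = fps_qpoch 3 3 n"

lemma qfac_0 [simp]: "qfac 0 = 1" and qfac_Suc: "qfac (Suc n) = qfac n * (1 - q3 ^ Suc n)"
  by (simp_all add: qfac_def q3_def fps_qpoch_def power_mult power_add)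

lemma one_minus_q3_power_nz: "n > 0 \<Longrightarrow> 1 - q3 ^ n \<noteq> 0"
  by (auto simp: q3_def fps_eq_iff simp flip: power_mult intro!: exI[of _ 0])

lemma qfac_nth_0 [simp]: "fps_nth (qfac n) 0 = 1"
  by (induction n) (simp_all add: qfac_Suc q3_def)

lemma qfac_nz [simp]: "qfac n \<noteq> 0"
  using qfac_nth_0[of n] by fastforce

lemma qfac_inverse: "qfac n * inverse (qfac n) = 1"
  by (simp add: inverse_mult_eq_1')

lemma inverse_qfac_Suc: "(1 - q3 ^ Suc n) * inverse (qfac (Suc n)) = inverse (qfac n)"
proof -
  have "qfac n * ((1 - q3 ^ Suc n) * inverse (qfac (Suc n))) = qfac n * inverse (qfac n)"
    using qfac_inverse[of "Suc n"] qfac_inverse[of n] by (simp only: qfac_Suc mult.assoc)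
  then show ?thesis by simp
qed

section \<open>Recurrence for the normalised coefficients a_n = c_n / (Q;Q)_n\<close>

definition acoeff :: "nat \<Rightarrow> nat \<Rightarrow> rat fps" where
  "acoeff i n = cseq i n * inverse (qfac n)"

lemma cseq_eq: "cseq i n = qfac n * acoeff i n"
  using qfac_inverse[of n] by (simp add: acoeff_def mult.left_commute)

lemma acoeff_0: "acoeff i 0 = 1"
  by (simp add: acoeff_def cseq_0)

lemma acoeff_1: "(1 - q3) * acoeff i 1 = fps_X ^ i + q3"
  using cseq_eq[of i 1] by (simp add: cseq_1 qfac_Suc q3_def)

lemma acoeff_2: "(1 - q3) * (1 - q3^2) * acoeff i 2
    = fps_X * q3 * (1 + fps_X + 2 * fps_X^2) - q3 * (1 - q3)^2 * acoeff i 1"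
proof -
  have P: "qfac 1 = 1 - q3" "qfac 2 = (1 - q3) * (1 - q3^2)"
    by (simp_all add: numeral_2_eq_2 qfac_Suc)
  show ?thesis using cseq_2[of i] unfolding cseq_eq P by algebra
qed

lemma acoeff_3: "(1 - q3^2) * (1 - q3^3) * acoeff i 3
    = fps_X * q3^2 * (1 + fps_X + 2 * fps_X^2 * q3) * acoeff i 1
       - q3^2 * (1 - q3) * (1 - q3^2) * acoeff i 2 - q3^3 * (1 - q3)"
proof -
  have P: "qfac 1 = 1 - q3" "qfac 2 = (1 - q3) * (1 - q3^2)" 
    "qfac 3 = (1 - q3) * (1 - q3^2) * (1 - q3^3)"
    by (simp_all add: numeral_2_eq_2 numeral_3_eq_3 qfac_Suc)
  have "(1 - q3) * ((1 - q3^2) * (1 - q3^3) * acoeff i 3)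
    = (1 - q3) * (fps_X * q3^2 * (1 + fps_X + 2 * fps_X^2 * q3) * acoeff i 1
       - q3^2 * (1 - q3) * (1 - q3^2) * acoeff i 2 - q3^3 * (1 - q3))"
    using cseq_3[of i] unfolding cseq_eq P by algebra
  then show ?thesis using one_minus_q3_power_nz[of 1] unfolding mult_cancel_left by simp
qed

text \<open>The factors 1 - q^(3n) and 1 - q^(3n-3) in the recurrence for \<open>cseq\<close> are
  exactly those that complete the shorter q-factorials to (Q;Q)_(n+2), so this becomes a common
  factor and cancels.\<close>

lemma acoeff_4:
  fixes n :: nat
  defines "y \<equiv> q3 ^ n"
  shows "(1 - y * q3^3) * (1 - y * q3^4) * acoeff i (n+4)
     = fps_X * y * q3^3 * (1 + fps_X + 2 * fps_X^2 * y * q3^2) * acoeff i (n+2)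
     - y * q3^3 * (1 - q3) * (1 - y * q3^3) * acoeff i (n+3)
     - y^2 * q3^5 * (1 - q3) * acoeff i (n+1)
     - y^2 * q3^5 * acoeff i n"
proof -
  have P: "qfac (n+1) = qfac n * (1 - y * q3)" 
    "qfac (n+2) = qfac n * (1 - y * q3) * (1 - y * q3^2)"
    "qfac (n+3) = qfac n * (1 - y * q3) * (1 - y * q3^2) * (1 - y * q3^3)"
    "qfac (n+4) = qfac n * (1 - y * q3) * (1 - y * q3^2) * (1 - y * q3^3) * (1 - y * q3^4)"
    using qfac_Suc[of n] qfac_Suc[of "n+1"] qfac_Suc[of "n+2"] qfac_Suc[of "n+3"]
    by (simp_all add: eval_nat_numeral y_def mult_ac)
  have nz: "qfac n * (1 - y * q3) * (1 - y * q3^2) \<noteq> 0"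
    using one_minus_q3_power_nz[of "n+1"] one_minus_q3_power_nz[of "n+2"]
    by (simp add: y_def power_add power2_eq_square mult_ac)
  have "(qfac n * (1 - y * q3) * (1 - y * q3^2)) * ((1 - y * q3^3) * (1 - y * q3^4) * acoeff i (n+4))
    = (qfac n * (1 - y * q3) * (1 - y * q3^2)) *
      (fps_X * y * q3^3 * (1 + fps_X + 2 * fps_X^2 * y * q3^2) * acoeff i (n+2)
     - y * q3^3 * (1 - q3) * (1 - y * q3^3) * acoeff i (n+3)
     - y^2 * q3^5 * (1 - q3) * acoeff i (n+1)
     - y^2 * q3^5 * acoeff i n)"
    using cseq_4[of i n] unfolding cseq_eq P y_def[symmetric] by algebra
  then show ?thesis using nz mult_cancel_left by blast
qed

section \<open>Generating functions in an outer variable x and their dilations F(x) -> F(c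
  x)\<close>

definition dil :: "'a::idom \<Rightarrow> 'a fps \<Rightarrow> 'a fps" where
  "dil c F = F oo (fps_const c * fps_X)"

lemma fps_nth_dil [simp]: "fps_nth (dil c F) n = c ^ n * fps_nth F n"
  by (simp add: dil_def fps_compose_linear)

lemma dil_mult: "dil c (F * G) = dil c F * dil c G"
  by (simp add: dil_def fps_compose_mult_distrib)

definition aser :: "nat \<Rightarrow> rat fps fps" where "aser i = Abs_fps (acoeff i)"
text \<open>By Euler's expansion this is E(x) = 1/(x;Q)_infinity. It is given by its coefficients,
  and its functional equation E(Q x) = (1 - x) E(x) is read off from them.\<close>

definition eser :: "rat fps fps" where "eser = Abs_fps (\<lambda>n. inverse (qfac n))"

lemma dil_eser: "dil q3 eser = (1 - fps_X) * eser"
proof (rule fps_ext)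
  fix n
  show "fps_nth (dil q3 eser) n = fps_nth ((1 - fps_X) * eser) n"
    using inverse_qfac_Suc by (cases n) (simp_all add: eser_def algebra_simps)
qed

lemma dil_dil_eser: "dil q3 (dil q3 eser) = (1 - fps_const q3 * fps_X) * dil q3 eser"
proof -
  have "dil q3 (1 - fps_X) = 1 - fps_const q3 * fps_X"
    by (rule fps_ext) (simp add: fps_X_def)
  then show ?thesis by (subst dil_eser) (simp add: dil_mult)
qed

text \<open>The coefficient of x^N is \<open>q3\<close> times the recurrence for a_N. The extra
  \<open>q3\<close> turns 1 - Q^(N-1) into Q - Q^N, so only the powers Q^N and Q^(2N) remain, which
  are the dilations \<open>T1\<close> and \<open>T2\<close>. For N = 0 and N = 1 the equation holds
  identically.\<close>

lemma aser_eq: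
  fixes i defines "T1 \<equiv> dil q3 (aser i)" and "T2 \<equiv> dil q3 (dil q3 (aser i))"
  shows "fps_const q3 * aser i = fps_const (q3 + 1) * T1
     - fps_X * (fps_const (q3 - q3^2) * T1) + fps_X^2 * (fps_const ((fps_X + fps_X^2) * q3^2) * T1)
     - T2 + fps_X * (fps_const (q3 - q3^2) * T2) + fps_X^2 * (fps_const (2 * q3^3) * T2)
     - fps_X^3 * (fps_const (q3^4 - q3^5) * T2) - fps_X^4 * (fps_const (q3^6) * T2)"
    (is "?L = ?R")
proof (rule fps_ext)
  \<comment> \<open>\<open>q3\<close> is otherwise treated as independent of X; the term X * 2 X^2
    of the recurrence is where X^3 = Q must be used.\<close>
  have cube: "fps_X * (fps_X * fps_X) = q3" "fps_X * (fps_X * (fps_X * f)) = q3 * f" for f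
    by (simp_all add: q3_def power_numeral_reduce mult.assoc)
  fix n :: nat
  consider "n = 0" | "n = 1" | "n = 2" | "n = 3" | m where "n = m + 4"
    by (cases n rule: nat_cases_3) (auto intro: nat_cases_3[of "n - 3"] simp: less_Suc_eq)
  then show "fps_nth ?L n = fps_nth ?R n"
  proof cases
    case 1
    then show ?thesis by (simp add: T1_def T2_def aser_def acoeff_0)
  next
    case 2
    then show ?thesis
      by (simp add: T1_def T2_def aser_def fps_X_power_mult_nth acoeff_0 power_numeral_reduce cube algebra_simps)
  next
    case 3
    show ?thesis using arg_cong[OF acoeff_2[of i], of "(*) q3"] unfolding 3
      by (simp add: T1_def T2_def aser_def fps_X_power_mult_nth acoeff_0 power_numeral_reduce cube algebra_simps)
  next
    case 4
    show ?thesis using arg_cong[OF acoeff_3[of i], of "(*) q3"] unfolding 4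
      by (simp add: T1_def T2_def aser_def fps_X_power_mult_nth acoeff_0 power_numeral_reduce cube algebra_simps)
  next
    case 5
    define y where "y = q3 ^ m"
    have p: "q3 ^ (m+k) = y * q3^k" for k by (simp add: y_def power_add)
    show ?thesis using arg_cong[OF acoeff_4[of m i, folded y_def], of "(*) q3"] unfolding 5
      by (simp add: T1_def T2_def aser_def fps_X_power_mult_nth p y_def[symmetric] power_numeral_reduce cube algebra_simps)
  qed
qed

definition gser :: "nat \<Rightarrow> rat fps fps" where "gser i = aser i * eser"

lemma gser_eq:
  fixes i defines "T1 \<equiv> dil q3 (gser i)" and "T2 \<equiv> dil q3 (dil q3 (gser i))"
  shows "fps_const q3 * gser i - fps_X * (fps_const q3 * gser i) = fps_const (q3 + 1) * T1
     - fps_X * (fps_const (q3 - q3^2) * T1) + fps_X^2 * (fps_const ((fps_X + fps_X^2) * q3^2) * T1)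
     - T2 - fps_X * (fps_const (q3^2) * T2) + fps_X^2 * (fps_const (q3^3) * T2)
     + fps_X^3 * (fps_const (q3^5) * T2)"
proof -
  have T: "T1 = dil q3 (aser i) * dil q3 eser" "T2 = dil q3 (dil q3 (aser i)) * dil q3 (dil q3 eser)"
    by (simp_all add: T1_def T2_def gser_def dil_mult)
  let ?c = "fps_const :: rat fps \<Rightarrow> _"
  let ?F = "aser i" let ?F1 = "dil q3 ?F" let ?F2 = "dil q3 ?F1"
  have two: "?c 2 = 2" by (simp add: numeral_fps_const)
  \<comment> \<open>The polynomial in front of F(Q^2 x) is factored so as to exhibit 1 - Q
    x.\<close>
  have F: "?c q3 * ?F = (?c q3 + 1) * ?F1 - fps_X * (?c q3 - ?c q3^2) * ?F1
     + fps_X^2 * ?c (fps_X + fps_X^2) * ?c q3^2 * ?F1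
     - (1 - ?c q3 * fps_X) * (1 + ?c q3^2 * fps_X - ?c q3^3 * fps_X^2 - ?c q3^5 * fps_X^3) * ?F2"
    unfolding aser_eq[of i]
    by (simp add: power_numeral_reduce algebra_simps two
             flip: fps_const_mult fps_const_add fps_const_sub fps_const_power)
  \<comment> \<open>Multiplication by E(Q x) = (1 - x) E(x) turns F(Q x) into G(Q x); in the last
    term 1 - Q x is absorbed by E(Q^2 x) = (1 - Q x) E(Q x).\<close>
  have "(1 - fps_X) * eser * (?c q3 * ?F) = (?c q3 + 1) * ?F1 * ((1 - fps_X) * eser)
     - fps_X * (?c q3 - ?c q3^2) * ?F1 * ((1 - fps_X) * eser)
     + fps_X^2 * ?c (fps_X + fps_X^2) * ?c q3^2 * ?F1 * ((1 - fps_X) * eser)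
     - (1 + ?c q3^2 * fps_X - ?c q3^3 * fps_X^2 - ?c q3^5 * fps_X^3) * ?F2 * 
       ((1 - ?c q3 * fps_X) * ((1 - fps_X) * eser))"
    unfolding F
    by (simp add: algebra_simps del: fps_const_mult fps_const_add fps_const_sub fps_const_power)
  then show ?thesis
    unfolding T gser_def dil_dil_eser unfolding dil_eser
      fps_const_mult[symmetric] fps_const_add[symmetric] fps_const_sub[symmetric] fps_const_power[symmetric]
    by (simp add: power_numeral_reduce algebra_simps
             del: fps_const_mult fps_const_add fps_const_sub fps_const_power)
qed

subsection \<open>The limit\<close>

lemma gser_0: "fps_nth (gser i) 0 = 1"
  by (simp add: gser_def aser_def eser_def acoeff_0)

lemma gser_1: "(1 - q3) * fps_nth (gser i) 1 = 1 + fps_X ^ i + q3"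
proof -
  have "(1 - q3) * inverse (qfac 1) = 1"
    using inverse_qfac_Suc[of 0] by simp
  moreover have "fps_nth (gser i) 1 = inverse (qfac 1) + acoeff i 1"
    by (simp add: gser_def aser_def eser_def acoeff_0 fps_mult_nth)
  ultimately show ?thesis using acoeff_1[of i] by (simp add: distrib_left)
qed

lemma gser_2: "(1 - q3) * (1 - q3^2) * fps_nth (gser i) 2
    = (1 - q3) * (1 + q3^2) * fps_nth (gser i) 1 + q3 * (fps_X + fps_X^2 + q3)"
proof -
  have "q3 * ((1 - q3) * (1 - q3^2) * fps_nth (gser i) 2)
    = q3 * ((1 - q3) * (1 + q3^2) * fps_nth (gser i) 1 + q3 * (fps_X + fps_X^2 + q3))"
    using arg_cong[OF gser_eq[of i], of "\<lambda>f. fps_nth f 2"]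
    by (simp add: fps_X_power_mult_nth gser_0 power_numeral_reduce algebra_simps)
  then show ?thesis by (simp add: q3_def)
qed

text \<open>This is the coefficient of x^(n+3) in \<open>gser_eq\<close>, divided by
  \<open>q3\<close>. Cancelling 1 - Q x has lowered the order of the recurrence from four to
  three.\<close>

lemma gser_3:
  fixes n :: nat
  defines "y \<equiv> q3 ^ n"
  shows "(1 - y*q3^2) * (1 - y*q3^3) * fps_nth (gser i) (n+3)
    = (1 - y*q3^2) * (1 + y*q3^3) * fps_nth (gser i) (n+2)
      + (y*q3^2 * (fps_X + fps_X^2) + y^2*q3^4) * fps_nth (gser i) (n+1)
      + y^2*q3^4 * fps_nth (gser i) n"
proof -
  have p: "q3 ^ (n+k) = y * q3^k" for k by (simp add: y_def power_add)
  have "q3 * ((1 - y*q3^2) * (1 - y*q3^3) * fps_nth (gser i) (n+3))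
    = q3 * ((1 - y*q3^2) * (1 + y*q3^3) * fps_nth (gser i) (n+2)
      + (y*q3^2 * (fps_X + fps_X^2) + y^2*q3^4) * fps_nth (gser i) (n+1)
      + y^2*q3^4 * fps_nth (gser i) n)"
    using arg_cong[OF gser_eq[of i], of "\<lambda>f. fps_nth f (n+3)"]
    by (simp add: fps_X_power_mult_nth p power_numeral_reduce algebra_simps y_def[symmetric])
  then show ?thesis by (simp add: q3_def)
qed

text \<open>The assumptions say that A = X^i and B have the sum and product of X and X^2. The
  coefficients of \<open>gser_3\<close> contain only these symmetric expressions, so A + B and A B
  can be put in their place.\<close>

lemma qfac_gser:
  assumes AB: "fps_X ^ i + B = fps_X + fps_X ^ 2" "fps_X ^ i * B = q3"
  shows "qfac n * fps_nth (gser i) n = capparelli q3 (fps_X ^ i) B n"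
proof (induction n rule: less_induct)
  case (less n)
  have P: "qfac 1 = 1 - q3" "qfac 2 = (1 - q3) * (1 - q3^2)"
    by (simp_all add: numeral_2_eq_2 qfac_Suc)
  show ?case
  proof (cases n rule: nat_cases_3)
    case 1
    then show ?thesis by (simp add: gser_0)
  next
    case 2
    then show ?thesis using gser_1[of i] P by simp
  next
    case 3
    have "qfac 2 * fps_nth (gser i) 2 = (1 + q3^2) * ((1 - q3) * fps_nth (gser i) 1) + q3 * (fps_X + fps_X^2 + q3)"
      unfolding P gser_2 by (simp add: algebra_simps)
    also have "\<dots> = capparelli q3 (fps_X ^ i) B 2"
      unfolding gser_1 numeral_2_eq_2 capparelli.simps unfolding AB by (simp add: AB numeral_2_eq_2)
    finally show ?thesis using 3 by simp
  next
    case (4 m)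
    define y where "y = q3 ^ m"
    define g where "g k = fps_nth (gser i) (m+k)" for k
    define h where "h k = capparelli q3 (fps_X ^ i) B (m+k)" for k
    define P where "P = qfac m"
    have P1: "qfac (m+1) = P * (1 - y * q3)"
      and P2: "qfac (m+2) = P * (1 - y * q3) * (1 - y * q3^2)"
      and P3: "qfac (m+3) = P * (1 - y * q3) * (1 - y * q3^2) * (1 - y * q3^3)"
      using qfac_Suc[of m] qfac_Suc[of "m+1"] qfac_Suc[of "m+2"]
      by (simp_all add: eval_nat_numeral y_def P_def mult_ac)
    have nz: "1 - y * q3^2 \<noteq> 0"
      using one_minus_q3_power_nz[of "m+2"]
      by (simp add: y_def power_add power2_eq_square mult_ac)
    have g3: "(1 - y*q3^2) * (1 - y*q3^3) * g 3 = (1 - y*q3^2) * (1 + y*q3^3) * g 2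
      + (y*q3^2 * (fps_X + fps_X^2) + y^2*q3^4) * g 1 + y^2*q3^4 * g 0"
      using gser_3[of m i] by (simp add: g_def y_def)
    have h3: "h 3 = (1 + y*q3^3) * h 2 + y*q3^2 * (fps_X + fps_X^2 + q3*y*q3) * h 1
                + q3*y^2*q3^3 * (1 - y*q3) * h 0"
    proof -
      have q: "q3 ^ (m+k) = y * q3^k" for k by (simp add: y_def power_add)
      have q2: "q3 ^ (2*m+3) = y^2 * q3^3" by (simp add: y_def power_add power_mult mult.commute)
      have "h 3 = capparelli q3 (fps_X ^ i) B (Suc (Suc (Suc m)))"
        by (simp add: h_def numeral_3_eq_3)
      then show ?thesis unfolding capparelli.simps q q2 AB
        by (simp add: h_def mult.assoc)
    qed
    have h0: "P * g 0 = h 0" using less.IH[of m] 4 by (simp add: g_def h_def P_def)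
    have h1: "P * (1 - y * q3) * g 1 = h 1"
      using less.IH[of "m+1"] 4 unfolding P1 by (simp add: g_def h_def)
    have h2: "P * (1 - y * q3) * (1 - y * q3^2) * g 2 = h 2"
      using less.IH[of "m+2"] 4 unfolding P2 by (simp add: g_def h_def)
    \<comment> \<open>The recurrence for g is scaled by (Q;Q)_(m+2). This leaves 1 - y Q^2 as a
      common factor on both sides, which is cancelled at the end.\<close>
    have "(1 - y * q3^2) * (P * (1 - y * q3) * (1 - y * q3^2) * (1 - y * q3^3) * g 3)
        = P * (1 - y * q3) * (1 - y * q3^2) * ((1 - y*q3^2) * (1 - y*q3^3) * g 3)"
      by (simp add: mult_ac)
    also have "\<dots> = (1 - y * q3^2) * ((1 + y*q3^3) * (P * (1 - y * q3) * (1 - y * q3^2) * g 2)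
        + (y*q3^2 * (fps_X + fps_X^2) + y^2*q3^4) * (P * (1 - y * q3) * g 1)
        + y^2*q3^4 * (1 - y * q3) * (P * g 0))"
      unfolding g3 by (simp add: algebra_simps)
    also have "\<dots> = (1 - y * q3^2) * h 3"
      unfolding h0 h1 h2 h3 by (simp add: power_numeral_reduce algebra_simps)
    finally show ?thesis using nz 4 by (simp add: g_def h_def P3)
  qed
qed

section \<open>A quantitative form of Abel's lemma\<close>

lemma cseq_dvd: "fps_X ^ n dvd cseq i (Suc n)"
proof -
  show ?thesis
  proof (cases n rule: nat_cases_3)
    case 1 then show ?thesis by simp
  next
    case 2
    have "cseq i (Suc n) = fps_X * (fps_X^2 * (fps_X * (1 + fps_X + 2 * fps_X^2) - (1 - q3) * cseq i 1))"
      using cseq_2[of i] 2 by (simp add: q3_def numeral_2_eq_2 power_numeral_reduce algebra_simps)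
    then show ?thesis using 2 by simp
  next
    case 3
    have "cseq i (Suc n) = q3^2 * (fps_X * (1 + fps_X + 2 * fps_X^2 * q3) * cseq i 1
     - (1 - q3) * cseq i 2 - q3 * (1 - q3)^2)"
      using cseq_3[of i] 3 by (simp add: power_numeral_reduce algebra_simps)
    moreover have "fps_X ^ 2 dvd q3^2"
      unfolding q3_def power_mult[symmetric] by (rule le_imp_power_dvd) simp
    ultimately show ?thesis using 3 by simp
  next
    case (4 m)
    have "cseq i (Suc n) = q3 ^ n * (fps_X * (1 + fps_X + 2 * fps_X^2 * q3 ^ m * q3^2) * cseq i (m+2)
     - (1 - q3) * cseq i (m+3)
     - q3 ^ m * q3^2 * (1 - q3) * (1 - q3 ^ m * q3^2) * cseq i (m+1)
     - q3 ^ m * q3^2 * (1 - q3 ^ m * q3^2) * (1 - q3 ^ m * q3) * cseq i m)"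
      using cseq_4[of i m] 4 by (simp add: power_add power_numeral_reduce algebra_simps)
    moreover have "fps_X ^ n dvd q3 ^ n"
      unfolding q3_def power_mult[symmetric] by (rule le_imp_power_dvd) simp
    ultimately show ?thesis by simp
  qed
qed

text \<open>The additional factors 1 - Q^j have j > m and are 1 modulo X^(m+1).\<close>

lemma qfac_dvd_diff: "fps_X ^ Suc m dvd qfac (m + d) - qfac m"
proof (induction d)
  case (Suc d)
  have "qfac (m + Suc d) - qfac m = (qfac (m + d) - qfac m) - q3 ^ Suc (m + d) * qfac (m + d)"
    by (simp add: qfac_Suc algebra_simps)
  moreover have "fps_X ^ Suc m dvd q3 ^ Suc (m + d)"
    unfolding q3_def power_mult[symmetric] by (rule le_imp_power_dvd) simp
  ultimately show ?case using Suc by (metis dvd_diff dvd_mult2)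
qed simp

text \<open>Since g_n is the sum of a_k / (Q;Q)_(n-k), the k-th error is a_k times ((Q;Q)_(n-k) -
  (Q;Q)_n) / (Q;Q)_(n-k). For k > 0 the numerator c_k supplies X^(k-1) and the difference supplies
  X^(n-k+1); for k = 0 the error is zero.\<close>

lemma partial_sum_dvd: "fps_X ^ n dvd (\<Sum>k\<le>n. acoeff i k) - qfac n * fps_nth (gser i) n"
proof -
  have "(\<Sum>k\<le>n. acoeff i k) - qfac n * fps_nth (gser i) n =
      (\<Sum>k\<le>n. acoeff i k - qfac n * (acoeff i k * inverse (qfac (n - k))))"
    by (simp add: gser_def fps_mult_nth aser_def eser_def sum_subtractf sum_distrib_left atLeast0AtMost)
  moreover have "fps_X ^ n dvd acoeff i k - qfac n * (acoeff i k * inverse (qfac (n - k)))"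
    if k: "k \<le> n" for k
  proof (cases k)
    case 0
    then show ?thesis using qfac_inverse[of n] by (simp add: acoeff_0)
  next
    case (Suc j)
    have "acoeff i k - qfac n * (acoeff i k * inverse (qfac (n - k))) =
       acoeff i k * (qfac (n - k) * inverse (qfac (n - k))) - qfac n * (acoeff i k * inverse (qfac (n - k)))"
      by (simp add: qfac_inverse)
    also have "\<dots> = - (cseq i k * (qfac (n - k + k) - qfac (n - k))) * inverse (qfac k) * inverse (qfac (n - k))"
      using k by (simp add: acoeff_def algebra_simps)
    finally have eq: "acoeff i k - qfac n * (acoeff i k * inverse (qfac (n - k))) = \<dots>" .
    have "fps_X ^ j * fps_X ^ Suc (n - k) dvd cseq i k * (qfac (n - k + k) - qfac (n - k))"
      unfolding Suc by (intro mult_dvd_mono cseq_dvd qfac_dvd_diff)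
    moreover have "fps_X ^ j * fps_X ^ Suc (n - k) = (fps_X ^ n :: rat fps)"
      using k Suc by (simp flip: power_add power_Suc)
    ultimately show ?thesis unfolding eq by simp
  qed
  ultimately show ?thesis by (auto intro!: dvd_sum)
qed

lemma acoeff_sums:
  assumes "fps_X ^ i + B = fps_X + fps_X ^ 2" "fps_X ^ i * B = q3"
    and "capparelli q3 (fps_X ^ i) B \<longlonglongrightarrow> L"
  shows "(\<lambda>n. cseq i n / fps_qpoch 3 3 n) sums L"
proof -
  have "(\<lambda>n. \<Sum>k\<le>n. acoeff i k) \<longlonglongrightarrow> L"
    using partial_sum_dvd[of _ i] assms(3) unfolding qfac_gser[OF assms(1,2)]
    by (rule tendsto_fps_cong)
  moreover have "cseq i n / fps_qpoch 3 3 n = acoeff i n" for n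
    using qfac_nth_0[of n] by (simp add: acoeff_def fps_divide_unit qfac_def)
  ultimately show ?thesis by (simp add: sums_def_le)
qed

section \<open>The limit of the Capparelli recurrence as an infinite product\<close>

lemma capparelli_tendsto: "capparelli q3 A B \<longlonglongrightarrow> lim (capparelli q3 A B)"
proof (rule convergent_fpsI)
  fix n
  have "fps_X ^ n dvd q3 ^ n"
    unfolding q3_def power_mult[symmetric] by (rule le_imp_power_dvd) simp
  then show "fps_X ^ n dvd capparelli q3 A B (Suc n) - capparelli q3 A B n"
    using capparelli_dvd_Suc dvd_trans by blast
qed

lemma capparelli_lim_swap: "lim (capparelli q3 A B) = (1 + A) * lim (capparelli q3 (B * q3) (A * q3))"
proof (rule LIMSEQ_unique)
  show "(\<lambda>n. capparelli q3 A B (Suc n)) \<longlonglongrightarrow> lim (capparelli q3 A B)"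
    using capparelli_tendsto by (rule LIMSEQ_Suc)
  have "(\<lambda>n. (1 + A) * capparelli q3 (B * q3) (A * q3) n) \<longlonglongrightarrow> (1 + A) * lim (capparelli q3 (B * q3) (A * q3))"
    by (intro tendsto_mult_fps tendsto_const capparelli_tendsto)
  moreover have "fps_X ^ n dvd capparelli q3 A B (Suc n) - (1 + A) * capparelli q3 (B * q3) (A * q3) n" for n
  proof -
    have "fps_X ^ n dvd q3 ^ Suc n"
      unfolding q3_def power_mult[symmetric] by (rule le_imp_power_dvd) simp
    then show ?thesis by (simp add: capparelli_swap)
  qed
  ultimately show "(\<lambda>n. capparelli q3 A B (Suc n)) \<longlonglongrightarrow> (1 + A) * lim (capparelli q3 (B * q3) (A * q3))"
    by (rule tendsto_fps_cong[rotated])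
qed

text \<open>Two swaps restore the order of the parameters, multiply both by Q^2 = X^6, and
  contribute the factors 1 + A and 1 + B Q.\<close>

lemma capparelli_lim_iterate:
  "lim (capparelli q3 (fps_X ^ a) (fps_X ^ b)) =
     (\<Prod>k<n. 1 - (-1) * fps_X ^ (a + 6 * k)) * (\<Prod>k<n. 1 - (-1) * fps_X ^ (b + 3 + 6 * k)) *
     lim (capparelli q3 (fps_X ^ (a + 6 * n)) (fps_X ^ (b + 6 * n)))"
proof (induction n)
  case (Suc n)
  let ?A = "fps_X ^ (a + 6 * n)" and ?B = "fps_X ^ (b + 6 * n)"
  have "lim (capparelli q3 ?A ?B) = (1 + ?A) * ((1 + ?B * q3) * lim (capparelli q3 (?A * q3 * q3) (?B * q3 * q3)))"
    by (simp add: capparelli_lim_swap[of ?A ?B] capparelli_lim_swap[of "?B * q3" "?A * q3"])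
  moreover have "?A * q3 * q3 = fps_X ^ (a + 6 * Suc n)" "?B * q3 * q3 = fps_X ^ (b + 6 * Suc n)"
     "?B * q3 = fps_X ^ (b + 3 + 6 * n)"
    by (simp_all add: q3_def ac_simps flip: power_add)
  ultimately show ?case unfolding Suc by (simp add: mult_ac)
qed simp

lemma capparelli_lim_0: "lim (capparelli q3 0 0) = qprod (-1) 3 3"
  using qprod_tendsto[of 3 "-1" 3]
  by (intro limI) (simp add: capparelli_0_0[abs_def] q3_def power_add flip: power_mult)

lemma capparelli_lim:
  "lim (capparelli q3 (fps_X ^ a) (fps_X ^ b)) = qprod (-1) a 6 * qprod (-1) (b+3) 6 * qprod (-1) 3 3"
proof (rule LIMSEQ_unique)
  let ?P = "\<lambda>n. (\<Prod>k<n. 1 - (-1) * fps_X ^ (a + 6 * k)) * (\<Prod>k<n. 1 - (-1) * fps_X ^ (b + 3 + 6 * k)) :: rat fps"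
  show "(\<lambda>n. lim (capparelli q3 (fps_X ^ a) (fps_X ^ b))) \<longlonglongrightarrow> lim (capparelli q3 (fps_X ^ a) (fps_X ^ b))"
    by simp
  have "(\<lambda>n. ?P n * qprod (-1) 3 3) \<longlonglongrightarrow> qprod (-1) a 6 * qprod (-1) (b+3) 6 * qprod (-1) 3 3"
    by (intro tendsto_mult_fps tendsto_const qprod_tendsto) simp_all
  moreover have "fps_X ^ n dvd lim (capparelli q3 (fps_X ^ a) (fps_X ^ b)) - ?P n * qprod (-1) 3 3" for n
  proof -
    let ?C = "capparelli q3 (fps_X ^ (a + 6 * n)) (fps_X ^ (b + 6 * n))"
    have d: "fps_X ^ n dvd ?C m - capparelli q3 0 0 m" for m
      by (intro capparelli_cong_dvd le_imp_power_dvd) simp_all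
    \<comment> \<open>After n double swaps both parameters are divisible by X^n. The congruence with
      parameters 0 holds at every m, hence coefficientwise in the limit.\<close>
    have "fps_X ^ n dvd lim ?C - lim (capparelli q3 0 0)"
      unfolding X_power_dvd_iff
    proof safe
      fix k assume "k < n"
      have "\<forall>\<^sub>F m in sequentially. fps_nth (?C m) k = fps_nth (lim ?C) k"
        "\<forall>\<^sub>F m in sequentially. fps_nth (capparelli q3 0 0 m) k = fps_nth (lim (capparelli q3 0 0)) k"
        using capparelli_tendsto by (simp_all add: tendsto_fps_iff)
      then have "\<forall>\<^sub>F m in sequentially. fps_nth (lim ?C - lim (capparelli q3 0 0)) k = 0"
        by eventually_elim (use d \<open>k < n\<close> in \<open>simp add: X_power_dvd_iff\<close>)
      then show "fps_nth (lim ?C - lim (capparelli q3 0 0)) k = 0" by simp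
    qed
    then have "fps_X ^ n dvd ?P n * (lim ?C - lim (capparelli q3 0 0))" by (rule dvd_mult)
    then show ?thesis
      by (subst capparelli_lim_iterate[of a b n]) (simp only: capparelli_lim_0 right_diff_distrib)
  qed
  ultimately show "(\<lambda>n. lim (capparelli q3 (fps_X ^ a) (fps_X ^ b))) \<longlonglongrightarrow> 
      qprod (-1) a 6 * qprod (-1) (b+3) 6 * qprod (-1) 3 3"
    by (rule tendsto_fps_cong[rotated])
qed

section \<open>Rewriting the products modulo 12\<close>

lemma qprod_neg_3: "qprod (-1) 3 3 * (qprod 1 3 12 * qprod 1 9 12) = 1"
proof -
  \<comment> \<open>Euler's identity (-Q;Q)_infinity (Q;Q^2)_infinity = 1, multiplied by the nonzero
    (Q^2;Q^2)_infinity.\<close>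
  have "qprod (-1) 3 3 * qprod 1 3 6 * qprod 1 6 6 = qprod 1 6 6"
    using qprod_neg_mult[of 3 3] qprod_split[of 3 1 3] by (simp add: mult.assoc)
  moreover have "qprod 1 3 6 = qprod 1 3 12 * qprod 1 9 12"
    using qprod_split[of 6 1 3] by simp
  ultimately show ?thesis using qprod_nz[of 6 6 1] by simp
qed

lemma capparelli_product_1:
  "qprod (-1) 1 6 * qprod (-1) 5 6 * qprod (-1) 3 3 =
     qprod 1 2 12 * qprod 1 10 12 /
      (qprod 1 1 12 * qprod 1 3 12 * qprod 1 5 12 * qprod 1 7 12 * qprod 1 9 12 * qprod 1 11 12)"
    (is "?L = ?N / ?D")
proof -
  have "qprod (-1) 1 6 * (qprod 1 1 12 * qprod 1 7 12) = qprod 1 2 12"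
    using qprod_neg_mult[of 6 1] qprod_split[of 6 1 1] by simp
  moreover have "qprod (-1) 5 6 * (qprod 1 5 12 * qprod 1 11 12) = qprod 1 10 12"
    using qprod_neg_mult[of 6 5] qprod_split[of 6 1 5] by simp
  moreover have "?L * ?D = (qprod (-1) 1 6 * (qprod 1 1 12 * qprod 1 7 12))
      * (qprod (-1) 5 6 * (qprod 1 5 12 * qprod 1 11 12))
      * (qprod (-1) 3 3 * (qprod 1 3 12 * qprod 1 9 12))"
    by (simp only: mult_ac)
  ultimately have "?L * ?D = ?N" by (simp only: qprod_neg_3 mult_1_right)
  moreover have "?D \<noteq> 0" by (simp add: qprod_nz)
  ultimately show ?thesis by (metis nonzero_mult_div_cancel_right)
qed

lemma capparelli_product_2:
  "qprod (-1) 2 6 * qprod (-1) 4 6 * qprod (-1) 3 3 =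
     1 / (qprod 1 2 12 * qprod 1 3 12 * qprod 1 9 12 * qprod 1 10 12)"
    (is "?L = 1 / ?D")
proof -
  have "qprod (-1) 2 6 * (qprod 1 2 12 * qprod 1 8 12) = qprod 1 4 12"
    using qprod_neg_mult[of 6 2] qprod_split[of 6 1 2] by simp
  moreover have "qprod (-1) 4 6 * (qprod 1 4 12 * qprod 1 10 12) = qprod 1 8 12"
    using qprod_neg_mult[of 6 4] qprod_split[of 6 1 4] by simp
  \<comment> \<open>The classes 4 and 8 modulo 12 occur in both preceding identities, on opposite
    sides. They are kept as a common factor here and cancelled afterwards.\<close>
  moreover have "qprod 1 4 12 * qprod 1 8 12 * (?L * ?D) =
      (qprod (-1) 2 6 * (qprod 1 2 12 * qprod 1 8 12))
      * (qprod (-1) 4 6 * (qprod 1 4 12 * qprod 1 10 12))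
      * (qprod (-1) 3 3 * (qprod 1 3 12 * qprod 1 9 12))"
    by (simp only: mult_ac)
  ultimately have "qprod 1 4 12 * qprod 1 8 12 * (?L * ?D) = qprod 1 4 12 * qprod 1 8 12 * 1"
    by (simp only: qprod_neg_3)
  then have "?L * ?D = 1" by (subst (asm) mult_cancel_left) (simp add: qprod_nz)
  moreover have "?D \<noteq> 0" by (simp add: qprod_nz)
  ultimately show ?thesis by (metis nonzero_mult_div_cancel_right)
qed

theorem theorem1p2:
  shows "((\<lambda>n. cseq 1 n / fps_qpoch 3 3 n) sums
           (fps_qpoch_inf 2 12 * fps_qpoch_inf 10 12 /
            (fps_qpoch_inf 1 12 * fps_qpoch_inf 3 12 * fps_qpoch_inf 5 12 *
             fps_qpoch_inf 7 12 * fps_qpoch_inf 9 12 * fps_qpoch_inf 11 12)) \<and>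
         (\<lambda>n. cseq 2 n / fps_qpoch 3 3 n) sums
           (1 / (fps_qpoch_inf 2 12 * fps_qpoch_inf 3 12 *
                 fps_qpoch_inf 9 12 * fps_qpoch_inf 10 12)))"
proof
  \<comment> \<open>For i = 1 the parameters are A = q, B = q^2, and B Q = q^5.\<close>
  have "capparelli q3 (fps_X ^ 1) (fps_X ^ 2) \<longlonglongrightarrow> qprod (-1) 1 6 * qprod (-1) 5 6 * qprod (-1) 3 3"
    using capparelli_tendsto[of "fps_X ^ 1" "fps_X ^ 2"] capparelli_lim[of 1 2] by simp
  then show "(\<lambda>n. cseq 1 n / fps_qpoch 3 3 n) sums
           (fps_qpoch_inf 2 12 * fps_qpoch_inf 10 12 /
            (fps_qpoch_inf 1 12 * fps_qpoch_inf 3 12 * fps_qpoch_inf 5 12 *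
             fps_qpoch_inf 7 12 * fps_qpoch_inf 9 12 * fps_qpoch_inf 11 12))"
    unfolding fps_qpoch_inf_eq_qprod capparelli_product_1[symmetric]
    by (rule acoeff_sums[rotated 2]) (simp_all add: q3_def power_numeral_reduce)
  \<comment> \<open>For i = 2 the roles are exchanged: A = q^2, B = q, and B Q = q^4.\<close>
  have "capparelli q3 (fps_X ^ 2) (fps_X ^ 1) \<longlonglongrightarrow> qprod (-1) 2 6 * qprod (-1) 4 6 * qprod (-1) 3 3"
    using capparelli_tendsto[of "fps_X ^ 2" "fps_X ^ 1"] capparelli_lim[of 2 1] by simp
  then show "(\<lambda>n. cseq 2 n / fps_qpoch 3 3 n) sums
           (1 / (fps_qpoch_inf 2 12 * fps_qpoch_inf 3 12 *
                 fps_qpoch_inf 9 12 * fps_qpoch_inf 10 12))"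
    unfolding fps_qpoch_inf_eq_qprod capparelli_product_2[symmetric]
    by (rule acoeff_sums[rotated 2]) (simp_all add: q3_def power_numeral_reduce)
qed

end
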